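(* Let $\mathbb{F}$ be a finite field, let $n$ be a positive integer with $n\leq \mathrm{char}(\mathbb{F})$, and let $G=U(n,\mathbb{F})$ be the group of upper triangular unipotent $n\times n$ matrices over $\mathbb{F}$. Then $|\widehat{G}|$ is divisible by $|G|$.
   Context: A semicharacter of a finite group $G$ is a function $f:G\to\mathbb{C}^{*}$ satisfying $f(ab)=f(a)f(b)$ for all pairs of commuting elements $a,b\in G$. The set $\widehat{G}$ of all semicharacters of $G$ is an abelian group under pointwise multiplication (it is finite whenever $G$ is finite). Upper triangular unipotent matrices are upper triangular matrices all of whose diagonal entries equal $1$. *)

theory Defs
  imports
    Complex_Main
    "HOL-Library.FuncSet"
    "HOL-Algebra.Multiplicative_Group"
    "HOL-Computational_Algebra.Polynomial"
    "Jordan_Normal_Form.Determinant"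
begin

definition unitriangular_group :: "'a::field itself \<Rightarrow> nat \<Rightarrow> 'a mat monoid" where
  "unitriangular_group ty n =
    \<lparr>carrier = {A \<in> carrier_mat n n. upper_triangular A \<and> (\<forall>i<n. A $$ (i, i) = 1)},
     monoid.mult = (*),
     one = 1\<^sub>m n\<rparr>"

text \<open>Semicharacters are functions on the carrier only, hence the extensional function space
  (value \<^const>\<open>undefined\<close> off the carrier); otherwise cardinalities would be meaningless.\<close>

definition semicharacters :: "('a, 'b) monoid_scheme \<Rightarrow> ('a \<Rightarrow> complex) set" where
  "semicharacters G =
    {f \<in> carrier G \<rightarrow>\<^sub>E (UNIV - {0}).
      \<forall>a\<in>carrier G. \<forall>b\<in>carrier G. a \<otimes>\<^bsub>G\<^esub> b = b \<otimes>\<^bsub>G\<^esub> a \<longrightarrow> f (a \<otimes>\<^bsub>G\<^esub> b) = f a * f b}"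

definition semicharacter_group :: "('a, 'b) monoid_scheme \<Rightarrow> ('a \<Rightarrow> complex) monoid" where
  "semicharacter_group G =
    \<lparr>carrier = semicharacters G,
     monoid.mult = (\<lambda>f g. \<lambda>a\<in>carrier G. f a * g a),
     one = (\<lambda>a\<in>carrier G. 1)\<rparr>"

lemma group_unitriangular_group: "group (unitriangular_group TYPE('a::field) n)"
proof (rule groupI)
  let ?G = "unitriangular_group TYPE('a) n"
  fix A B C assume A: "A \<in> carrier ?G" and B: "B \<in> carrier ?G" and C: "C \<in> carrier ?G"
  show "A \<otimes>\<^bsub>?G\<^esub> B \<otimes>\<^bsub>?G\<^esub> C = A \<otimes>\<^bsub>?G\<^esub> (B \<otimes>\<^bsub>?G\<^esub> C)"
    using A B C by (auto simp: unitriangular_group_def intro: assoc_mult_mat)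
next
  let ?G = "unitriangular_group TYPE('a) n"
  show "\<one>\<^bsub>?G\<^esub> \<in> carrier ?G" by (auto simp: unitriangular_group_def)
next
  let ?G = "unitriangular_group TYPE('a) n"
  fix A assume "A \<in> carrier ?G"
  then show "\<one>\<^bsub>?G\<^esub> \<otimes>\<^bsub>?G\<^esub> A = A" by (auto simp: unitriangular_group_def)
next
  let ?G = "unitriangular_group TYPE('a) n"
  fix A B assume "A \<in> carrier ?G" "B \<in> carrier ?G"
  then have A: "A \<in> carrier_mat n n" and B: "B \<in> carrier_mat n n"
    and zA: "\<And>i j. j < i \<Longrightarrow> i < n \<Longrightarrow> A $$ (i, j) = 0"
    and zB: "\<And>i j. j < i \<Longrightarrow> i < n \<Longrightarrow> B $$ (i, j) = 0"
    and oA: "\<And>i. i < n \<Longrightarrow> A $$ (i, i) = 1" and oB: "\<And>i. i < n \<Longrightarrow> B $$ (i, i) = 1"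
    by (auto simp: unitriangular_group_def)
  have entry: "(A * B) $$ (i, j) = (\<Sum>k<n. A $$ (i, k) * B $$ (k, j))" if "i < n" "j < n" for i j
    using A B that by (auto simp: scalar_prod_def lessThan_atLeast0 intro!: sum.cong)
  have "(A * B) $$ (i, j) = 0" if "j < i" "i < n" for i j
  proof -
    have "A $$ (i, k) * B $$ (k, j) = 0" if "k < n" for k
      using zA[of k i] zB[of j k] that \<open>j < i\<close> \<open>i < n\<close> by (cases "k < i") auto
    then have "(\<Sum>k<n. A $$ (i, k) * B $$ (k, j)) = 0" by (intro sum.neutral) auto
    then show ?thesis using entry[of i j] that by simp
  qed
  moreover have "(A * B) $$ (i, i) = 1" if "i < n" for i
  proof -
    have "A $$ (i, k) * B $$ (k, i) = (if k = i then 1 else 0)" if "k < n" for k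
      using zA[of k i] zB[of i k] oA[of i] oB[of i] that \<open>i < n\<close> by (cases k i rule: linorder_cases) auto
    then have "(A * B) $$ (i, i) = (\<Sum>k<n. if k = i then 1 else 0)"
      using entry[of i i] that by simp
    then show ?thesis using that by simp
  qed
  ultimately show "A \<otimes>\<^bsub>?G\<^esub> B \<in> carrier ?G"
    using A B by (auto simp: unitriangular_group_def)
next
  let ?G = "unitriangular_group TYPE('a) n"
  fix A assume "A \<in> carrier ?G"
  then have A: "A \<in> carrier_mat n n" and utA: "upper_triangular A"
    and zA: "\<And>i j. j < i \<Longrightarrow> i < n \<Longrightarrow> A $$ (i, j) = 0"
    and oA: "\<And>i. i < n \<Longrightarrow> A $$ (i, i) = 1"
    by (auto simp: unitriangular_group_def)
  have "det A = prod_list (diag_mat A)" by (rule det_upper_triangular[OF utA A])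
  also have "diag_mat A = map (\<lambda>_. 1) [0..<n]" using A oA by (auto simp: diag_mat_def)
  also have "prod_list (map (\<lambda>_. 1) [0..<n]) = (1::'a)" by (induction n) auto
  finally have "det A \<noteq> 0" by simp
  from det_non_zero_imp_unit[OF A this, unfolded Units_def, of "()"]
  obtain B where B: "B \<in> carrier_mat n n" and BA: "B * A = 1\<^sub>m n"
    by (auto simp: ring_mat_def)
  have entry: "(\<Sum>k<n. B $$ (i, k) * A $$ (k, j)) = (if i = j then 1 else 0)"
    if "i < n" "j < n" for i j
  proof -
    have "(B * A) $$ (i, j) = (\<Sum>k<n. B $$ (i, k) * A $$ (k, j))"
      using A B that by (auto simp: scalar_prod_def lessThan_atLeast0 intro!: sum.cong)
    then show ?thesis using BA that by simp
  qed
  have low: "B $$ (i, j) = (if i = j then 1 else 0)" if "i < n" "j \<le> i" for i j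
    using that
  proof (induction j rule: less_induct)
    case (less j)
    have "B $$ (i, k) * A $$ (k, j) = (if k = j then B $$ (i, j) else 0)" if "k < n" for k
      using less.IH[of k] less.prems zA[of j k] oA[of j] that
      by (cases k j rule: linorder_cases) auto
    then have "(\<Sum>k<n. B $$ (i, k) * A $$ (k, j)) = (\<Sum>k<n. if k = j then B $$ (i, j) else 0)"
      by (intro sum.cong) auto
    also have "\<dots> = B $$ (i, j)" using less.prems by simp
    finally show ?case using entry[of i j] less.prems by simp
  qed
  show "\<exists>B\<in>carrier ?G. B \<otimes>\<^bsub>?G\<^esub> A = \<one>\<^bsub>?G\<^esub>"
    using B BA low by (intro bexI[of _ B]) (auto simp: unitriangular_group_def)
qed

lemma comm_group_semicharacter_group:
  assumes "group G"
  shows "comm_group (semicharacter_group G)"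
proof -
  interpret group G by fact
  show ?thesis
  proof (rule comm_groupI)
    fix f assume f: "f \<in> carrier (semicharacter_group G)"
    let ?g = "\<lambda>a\<in>carrier G. inverse (f a)"
    have "?g \<in> carrier (semicharacter_group G)"
      using f by (auto simp: semicharacter_group_def semicharacters_def PiE_iff)
    moreover have "?g \<otimes>\<^bsub>semicharacter_group G\<^esub> f = \<one>\<^bsub>semicharacter_group G\<^esub>"
      using f by (auto simp: semicharacter_group_def semicharacters_def PiE_iff fun_eq_iff)
    ultimately show "\<exists>g\<in>carrier (semicharacter_group G).
        g \<otimes>\<^bsub>semicharacter_group G\<^esub> f = \<one>\<^bsub>semicharacter_group G\<^esub>" by blast
  next
    fix f assume "f \<in> carrier (semicharacter_group G)"
    then show "\<one>\<^bsub>semicharacter_group G\<^esub> \<otimes>\<^bsub>semicharacter_group G\<^esub> f = f"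
      by (auto simp: semicharacter_group_def semicharacters_def PiE_iff fun_eq_iff extensional_def)
  qed (auto simp: semicharacter_group_def semicharacters_def PiE_iff fun_eq_iff mult.assoc
      mult.left_commute)
qed

text \<open>Finiteness guarantees that the order of the semicharacter group is not the default value
  \<open>0\<close> that \<^const>\<open>card\<close> assigns to infinite sets.\<close>

lemma finite_semicharacters:
  assumes "group G" "finite (carrier G)"
  shows "finite (semicharacters G)"
proof -
  interpret group G by fact
  have pow: "f (a [^]\<^bsub>G\<^esub> Suc k) = f a ^ Suc k"
    if f: "f \<in> semicharacters G" and a: "a \<in> carrier G" for f a k
  proof (induction k)
    case 0
    then show ?case using a by simp
  next
    case (Suc k)
    have "a [^]\<^bsub>G\<^esub> Suc k \<otimes>\<^bsub>G\<^esub> a = a \<otimes>\<^bsub>G\<^esub> a [^]\<^bsub>G\<^esub> Suc k"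
      using a by (metis nat_pow_Suc nat_pow_Suc2)
    then have "f (a [^]\<^bsub>G\<^esub> Suc k \<otimes>\<^bsub>G\<^esub> a) = f (a [^]\<^bsub>G\<^esub> Suc k) * f a"
      using f a unfolding semicharacters_def by blast
    then show ?case using Suc.IH by (simp add: mult.commute)
  qed
  have root: "f a ^ Coset.order G = 1" if f: "f \<in> semicharacters G" and a: "a \<in> carrier G" for f a
  proof -
    have "Coset.order G > 0" using assms(2) order_gt_0_iff_finite by blast
    then obtain k where k: "Coset.order G = Suc k" by (cases "Coset.order G") auto
    have "f \<one>\<^bsub>G\<^esub> = f \<one>\<^bsub>G\<^esub> * f \<one>\<^bsub>G\<^esub>" and "f \<one>\<^bsub>G\<^esub> \<noteq> 0"
      using f by (force simp: semicharacters_def)+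
    then have "f \<one>\<^bsub>G\<^esub> = 1" by simp
    then show ?thesis using pow[OF f a, of k] pow_order_eq_1[OF a] k by simp
  qed
  have "Coset.order G > 0" using assms(2) order_gt_0_iff_finite by blast
  then have "finite {z::complex. z ^ Coset.order G = 1}"
    using finite_roots_unity[of "Coset.order G", where 'a = complex] by simp
  then have "finite (carrier G \<rightarrow>\<^sub>E {z::complex. z ^ Coset.order G = 1})"
    using assms(2) by (rule_tac finite_PiE) auto
  moreover have "semicharacters G \<subseteq> carrier G \<rightarrow>\<^sub>E {z. z ^ Coset.order G = 1}"
  proof
    fix f assume f: "f \<in> semicharacters G"
    then have "f \<in> extensional (carrier G)" by (simp add: semicharacters_def PiE_iff)
    then show "f \<in> carrier G \<rightarrow>\<^sub>E {z. z ^ Coset.order G = 1}" using root[OF f] by (simp add: PiE_iff)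
  qed
  ultimately show ?thesis by (rule rev_finite_subset)
qed

lemma finite_carrier_unitriangular_group:
  "finite (carrier (unitriangular_group TYPE('a::{field,finite}) n))"
proof (rule finite_subset)
  show "carrier (unitriangular_group TYPE('a) n)
      \<subseteq> (\<lambda>g. mat n n g) ` (({0..<n} \<times> {0..<n}) \<rightarrow>\<^sub>E UNIV)"
  proof
    fix A :: "'a mat" assume "A \<in> carrier (unitriangular_group TYPE('a) n)"
    then have "A = mat n n (restrict (\<lambda>ij. A $$ ij) ({0..<n} \<times> {0..<n}))"
      by (intro eq_matI) (auto simp: unitriangular_group_def)
    then show "A \<in> (\<lambda>g. mat n n g) ` (({0..<n} \<times> {0..<n}) \<rightarrow>\<^sub>E UNIV)"
      by (rule image_eqI[OF _ restrict_PiE_iff[THEN iffD2]]) auto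
  qed
  show "finite ((\<lambda>g. mat n n g) ` (({0..<n} \<times> {0..<n}) \<rightarrow>\<^sub>E (UNIV :: 'a set)))"
    by (intro finite_imageI finite_PiE) auto
qed

end

theory Submission
  imports Defs "HOL-Number_Theory.Cong"
begin

text \<open>Let \<open>p\<close> be the characteristic. For a unipotent \<open>u\<close> and \<open>i < j\<close>, the entry \<open>(i, j)\<close> of \<open>u ^ m\<close> is
  a polynomial in \<open>m\<close> of degree at most \<open>j - i < p\<close>, hence determined by its values at \<open>0, \<dots>, p - 1\<close>.
  Its linear coefficient is the entry \<open>(i, j)\<close> of the matrix logarithm of \<open>u\<close>. If \<open>u\<close> and \<open>v\<close>
  commute, then \<open>(u v) ^ m = u ^ m v ^ m\<close>, and comparing linear coefficients shows that the logarithm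
  turns the product \<open>u v\<close> into a sum. Composing the logarithm with the additive characters of the
  space of strictly upper triangular matrices therefore gives a subgroup of the semicharacter group,
  and it has the order of the group itself.\<close>

section \<open>Additive characters of finite fields\<close>

text \<open>The characteristic is a prime not dividing \<open>k\<close>, so Bezout inverts
  \<open>k\<close> modulo it: inverses of nonzero elements of the prime field are again images of
  integers.\<close>

lemma of_int_inverse_exists:
  assumes "of_int k \<noteq> (0::'a::{field,finite})"
  shows "\<exists>l. of_int k * of_int l = (1::'a)"
proof -
  have "\<not> int CHAR('a) dvd k" using assms by (simp add: of_int_eq_0_iff_char_dvd)
  moreover have "prime (int CHAR('a))"
    using prime_CHAR_semidom[where 'a = 'a] finite_imp_CHAR_pos[where 'a = 'a] by simp
  ultimately have "coprime k (int CHAR('a))"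
    using prime_imp_coprime coprime_commute by blast
  then obtain l where "[k * l = 1] (mod int CHAR('a))"
    using cong_solve_coprime_int by blast
  then show ?thesis
    by (metis of_int_1 of_int_eq_iff_cong_CHAR of_int_mult)
qed

lemma of_int_mult_mem:
  fixes x :: "'a::ring_1"
  assumes zero: "0 \<in> H" and diff: "\<And>x y. x \<in> H \<Longrightarrow> y \<in> H \<Longrightarrow> x - y \<in> H" and "x \<in> H"
  shows "of_int k * x \<in> H"
proof (induction k rule: int_induct[of _ 0])
  case base
  show ?case using zero by simp
next
  case (step1 i)
  have "of_int i * x - (0 - x) \<in> H" using step1 assms by blast
  then show ?case by (simp add: algebra_simps)
next
  case (step2 i)
  then show ?case using diff[OF _ \<open>x \<in> H\<close>] by (simp add: algebra_simps)
qed

text \<open>A maximal subgroup avoiding 1 is a complement of the prime field, which gives a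
  projection onto the prime field without choosing a basis.\<close>

lemma exists_maximal_additive_subgroup:
  "\<exists>H :: 'a::{field,finite} set. 0 \<in> H \<and> 1 \<notin> H \<and> (\<forall>x\<in>H. \<forall>y\<in>H. x - y \<in> H) \<and>
     (\<forall>x. \<exists>k::int. x - of_int k \<in> H)"
proof -
  define S :: "'a set set" where
    "S = {H. 0 \<in> H \<and> 1 \<notin> H \<and> (\<forall>x\<in>H. \<forall>y\<in>H. x - y \<in> H)}"
  have "{0} \<in> S" by (simp add: S_def)
  then obtain H where H: "H \<in> S" and max: "\<And>K. K \<in> S \<Longrightarrow> H \<subseteq> K \<Longrightarrow> K = H"
    using finite_has_maximal[of S] by (auto simp: finite)
  from H have zero: "0 \<in> H" and one: "1 \<notin> H" and diff: "\<And>x y. x \<in> H \<Longrightarrow> y \<in> H \<Longrightarrow> x - y \<in> H"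
    by (auto simp: S_def)
  have neg: "- x \<in> H" if "x \<in> H" for x using diff[OF zero that] by simp
  have "\<exists>k::int. x - of_int k \<in> H" for x
  proof (cases "x \<in> H")
    case True
    then show ?thesis by (intro exI[of _ 0]) simp
  next
    case False
    \<comment> \<open>\<open>K\<close> is the subgroup generated by \<open>H\<close> and
      \<open>x\<close>. By maximality it contains 1, so 1 is congruent to \<open>k * x\<close>
      modulo \<open>H\<close>; inverting \<open>k\<close> makes \<open>x\<close> congruent to an
      integer.\<close>
    define K where "K = {y. \<exists>k::int. y - of_int k * x \<in> H}"
    have "H \<subseteq> K" by (auto simp: K_def intro: exI[of _ 0])
    moreover have "x \<in> K" using zero by (auto simp: K_def intro!: exI[of _ 1])
    ultimately have "K \<notin> S" using max False by blast
    moreover have "0 \<in> K" using \<open>H \<subseteq> K\<close> zero by auto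
    moreover have "y - z \<in> K" if "y \<in> K" "z \<in> K" for y z
    proof -
      from that obtain k l :: int where "y - of_int k * x \<in> H" "z - of_int l * x \<in> H"
        by (auto simp: K_def)
      from diff[OF this] show ?thesis
        unfolding K_def by (auto simp: algebra_simps intro!: exI[of _ "k - l"])
    qed
    ultimately have "1 \<in> K" by (auto simp: S_def)
    then obtain k :: int where k: "1 - of_int k * x \<in> H" by (auto simp: K_def)
    have "of_int k \<noteq> (0::'a)" using k one by auto
    from of_int_inverse_exists[OF this] obtain l where l: "of_int k * of_int l = (1::'a)" ..
    have "x - of_int l = - (of_int l * (1 - of_int k * x))"
      using l by (simp add: algebra_simps)
    then show ?thesis using neg[OF of_int_mult_mem[OF zero diff k]] by metis
  qed
  then show ?thesis using zero one diff by blast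
qed

text \<open>Project onto the prime field along \<open>H\<close>, then send the residue of
  \<open>k\<close> modulo \<open>p\<close> to the root of unity exp(2 pi i k / p).\<close>

lemma exists_nontrivial_additive_character:
  "\<exists>\<psi> :: 'a::{field,finite} \<Rightarrow> complex. (\<forall>x y. \<psi> (x + y) = \<psi> x * \<psi> y) \<and> \<psi> 0 = 1 \<and> (\<exists>x. \<psi> x \<noteq> 1)"
proof -
  obtain H :: "'a set" where zero: "0 \<in> H" and one: "1 \<notin> H"
    and diff: "\<And>x y. x \<in> H \<Longrightarrow> y \<in> H \<Longrightarrow> x - y \<in> H" and ex: "\<And>x. \<exists>k::int. x - of_int k \<in> H"
    using exists_maximal_additive_subgroup by metis
  define p where "p = int CHAR('a)"
  have p: "prime p"
    unfolding p_def using prime_CHAR_semidom[where 'a = 'a] finite_imp_CHAR_pos[where 'a = 'a] by simp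
  then have p1: "p > 1" by (rule prime_gt_1_int)
  have neg: "- x \<in> H" if "x \<in> H" for x using diff[OF zero that] by simp
  have add: "x + y \<in> H" if "x \<in> H" "y \<in> H" for x y using diff[OF that(1) neg[OF that(2)]] by simp
  \<comment> \<open>An integer prime to \<open>p\<close> has an inverse in the prime field, so its
    membership in \<open>H\<close> would force 1 into \<open>H\<close>. Hence \<open>H\<close> meets
    the prime field only in 0.\<close>
  have dvd: "p dvd k" if "of_int k \<in> H" for k :: int
  proof (rule ccontr)
    assume "\<not> p dvd k"
    then have "of_int k \<noteq> (0::'a)" by (simp add: p_def of_int_eq_0_iff_char_dvd)
    from of_int_inverse_exists[OF this] obtain l where "of_int k * of_int l = (1::'a)" ..
    then show False using of_int_mult_mem[OF zero diff that, of l] one by (simp add: mult.commute)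
  qed
  define e where "e k = cis (2 * pi * (of_int k / of_int p))" for k :: int
  have e_add: "e (k + l) = e k * e l" for k l
    by (simp add: e_def cis_mult add_divide_distrib distrib_left)
  have e_p: "e (p * k) = 1" for k
    using p1 by (simp add: e_def)
  have e_cong: "e k = e l" if "of_int (k - l) \<in> H" for k l
  proof -
    obtain q where "k - l = p * q" using dvd \<open>of_int (k - l) \<in> H\<close> by blast
    then have "k = l + p * q" by simp
    then show ?thesis by (simp add: e_add e_p)
  qed
  \<comment> \<open>The representative \<open>\<kappa> x\<close> is arbitrary and need not be
    additive in \<open>x\<close>; \<open>e\<close> depends only on its class modulo
    \<open>p\<close>, so \<open>e (\<kappa> x)\<close> is multiplicative.\<close>
  obtain \<kappa> :: "'a \<Rightarrow> int" where \<kappa>: "\<And>x. x - of_int (\<kappa> x) \<in> H" using ex by metis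
  have \<psi>: "e (\<kappa> x) = e k" if "x - of_int k \<in> H" for x k
    using diff[OF that \<kappa>[of x]] by (intro e_cong) simp
  have "e (\<kappa> (x + y)) = e (\<kappa> x) * e (\<kappa> y)" for x y
  proof -
    have "e (\<kappa> (x + y)) = e (\<kappa> x + \<kappa> y)"
      using add[OF \<kappa>[of x] \<kappa>[of y]] by (intro \<psi>) (simp add: algebra_simps)
    then show ?thesis by (simp add: e_add)
  qed
  moreover have "e (\<kappa> 0) = 1"
    using \<psi>[of 0 0] zero e_p[of 0] by simp
  moreover have "e (\<kappa> 1) \<noteq> 1"
  proof
    assume "e (\<kappa> 1) = 1"
    then have "e 1 = 1" using \<psi>[of 1 1] zero by simp
    then have "cos (2 * pi * (1 / of_int p)) = 1"
      by (simp add: e_def complex_eq_iff)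
    then obtain k :: int where "2 * pi * (1 / of_int p) = of_int k * 2 * pi"
      using cos_one_2pi_int by blast
    then have "1 = of_int k * (of_int p :: real)" using p1 by (simp add: field_simps)
    then have "1 = k * p" by (metis of_int_1 of_int_eq_iff of_int_mult)
    then have "p dvd 1" by (metis dvd_triv_right)
    with p1 show False by simp
  qed
  ultimately show ?thesis by (intro exI[of _ "e \<circ> \<kappa>"]) auto
qed

section \<open>Logarithms of unipotent matrices\<close>

text \<open>Discrete integration: each falling factorial integrates to the next one divided by a
  positive integer at most \<open>d\<close>, which is invertible because
  \<open>d < CHAR('a)\<close>.\<close>

lemma antidifference_poly:
  fixes Q :: "'a::field poly"
  assumes "\<And>k. k \<ge> d \<Longrightarrow> coeff Q k = 0" "d < CHAR('a)"
  shows "\<exists>P. degree P \<le> d \<and> poly P 0 = 0 \<and> (\<forall>x. poly P (x + 1) = poly P x + poly Q x)"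
  using assms
proof (induction d arbitrary: Q)
  case 0
  then have "Q = 0" by (intro poly_eqI) simp
  then show ?case by (intro exI[of _ 0]) simp
next
  case (Suc d)
  \<comment> \<open>The falling factorials \<open>b k\<close> satisfy \<open>b (k + 1) (x + 1) - b (k + 1) x = (k + 1) b k x\<close>.\<close>
  define b :: "nat \<Rightarrow> 'a poly" where "b k = (\<Prod>i<k. [:- of_nat i, 1:])" for k
  have deg_b: "degree (b k) = k" for k
    unfolding b_def by (subst degree_prod_sum_eq) auto
  have lead_b: "coeff (b k) k = 1" for k
  proof -
    have "lead_coeff (b k) = 1" by (simp add: b_def lead_coeff_prod)
    then show ?thesis by (simp add: deg_b)
  qed
  have poly_b: "poly (b k) x = (\<Prod>i<k. x - of_nat i)" for k x
    by (simp add: b_def poly_prod)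
  have diff_b: "poly (b (Suc k)) (x + 1) = poly (b (Suc k)) x + of_nat (Suc k) * poly (b k) x" for k x
  proof -
    have "poly (b (Suc k)) (x + 1) = (x + 1) * poly (b k) x"
      unfolding poly_b prod.lessThan_Suc_shift by simp
    moreover have "poly (b (Suc k)) x = poly (b k) x * (x - of_nat k)"
      by (simp add: poly_b)
    ultimately show ?thesis by (simp add: algebra_simps)
  qed
  have nz: "of_nat (Suc d) \<noteq> (0::'a)"
    using Suc.prems(2) unfolding of_nat_eq_0_iff_char_dvd by (auto dest: dvd_imp_le)
  \<comment> \<open>Since \<open>b d\<close> is monic of degree \<open>d\<close>, subtracting
    \<open>q\<close> times it removes the top term, and the induction hypothesis integrates the
    rest.\<close>
  define q where "q = coeff Q d"
  have "coeff (Q - smult q (b d)) k = 0" if "k \<ge> d" for k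
    using Suc.prems(1)[of k] that deg_b[of d]
    by (cases "k = d") (auto simp: q_def lead_b coeff_eq_0)
  from Suc.IH[OF this] Suc.prems(2) obtain P where P: "degree P \<le> d" "poly P 0 = 0"
    "\<And>x. poly P (x + 1) = poly P x + poly (Q - smult q (b d)) x"
    by auto
  define R where "R = P + smult (q / of_nat (Suc d)) (b (Suc d))"
  have "degree R \<le> Suc d"
    unfolding R_def using P(1) deg_b[of "Suc d"]
    by (intro degree_add_le order.trans[OF degree_smult_le]) auto
  moreover have "poly R 0 = 0"
  proof -
    have "poly (b (Suc d)) 0 = 0" unfolding poly_b prod.lessThan_Suc_shift by simp
    then show ?thesis by (simp add: R_def P)
  qed
  moreover have "poly R (x + 1) = poly R x + poly Q x" for x
    using nz by (simp add: R_def P diff_b distrib_left del: of_nat_Suc)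
  ultimately show ?case by blast
qed

text \<open>The naturals below the characteristic have distinct images, which is more points than
  either degree.\<close>

lemma poly_eq_if_eq_on_nat:
  fixes P Q :: "'a::field poly"
  assumes "degree P < CHAR('a)" "degree Q < CHAR('a)" "\<And>m. poly P (of_nat m) = poly Q (of_nat m)"
  shows "P = Q"
proof -
  have "inj_on (of_nat :: nat \<Rightarrow> 'a) {..<CHAR('a)}"
    by (auto simp: inj_on_def of_nat_eq_iff_cong_CHAR cong_less_modulus_unique_nat)
  then have "card (of_nat ` {..<CHAR('a)} :: 'a set) = CHAR('a)"
    by (simp add: card_image)
  then show ?thesis
    using assms by (intro poly_eqI_degree[of "of_nat ` {..<CHAR('a)}"]) auto
qed

section \<open>Powers of unitriangular matrices and their logarithms\<close>

locale unitriangular =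
  fixes n :: nat and G :: "'a::field mat monoid" (structure)
  assumes G_eq: "G = unitriangular_group TYPE('a) n"
    and n_le_char: "n \<le> CHAR('a)"

sublocale unitriangular \<subseteq> group G
  unfolding G_eq by (rule group_unitriangular_group)

context unitriangular
begin

lemma mem_carrier_iff:
  "u \<in> carrier G \<longleftrightarrow> u \<in> carrier_mat n n \<and>
     (\<forall>i<n. u $$ (i, i) = 1) \<and> (\<forall>i<n. \<forall>j<i. u $$ (i, j) = 0)"
  by (auto simp: G_eq unitriangular_group_def)

lemma one_eq: "\<one> = 1\<^sub>m n"
  by (simp add: G_eq unitriangular_group_def)

lemma mult_entry:
  assumes "u \<in> carrier G" "v \<in> carrier G" "i \<le> j" "j < n"
  shows "(u \<otimes> v) $$ (i, j) = (\<Sum>s=i..j. u $$ (i, s) * v $$ (s, j))"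
proof -
  have "(u \<otimes> v) $$ (i, j) = (\<Sum>s\<in>{0..<n}. u $$ (i, s) * v $$ (s, j))"
    using assms by (auto simp: G_eq unitriangular_group_def scalar_prod_def intro!: sum.cong)
  also have "\<dots> = (\<Sum>s=i..j. u $$ (i, s) * v $$ (s, j))"
    using assms by (intro sum.mono_neutral_right) (auto simp: mem_carrier_iff not_le)
  finally show ?thesis .
qed

text \<open>By \<open>u ^ (m + 1) = u ^ m * u\<close> and the unit diagonal, the difference in
  \<open>m\<close> of entry \<open>(i, j)\<close> is a combination of the entries
  \<open>(i, s)\<close> with \<open>s < j\<close>. Integrating it raises the degree by at most
  one.\<close>

lemma power_entry_poly:
  assumes u: "u \<in> carrier G" and "i \<le> j" "j < n"
  shows "\<exists>P. degree P \<le> j - i \<and> (\<forall>m::nat. poly P (of_nat m) = (u [^] m) $$ (i, j))"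
  using assms(2,3)
proof (induction j rule: less_induct)
  case (less j)
  show ?case
  proof (cases "i = j")
    case True
    have "(u [^] m) $$ (i, i) = 1" for m :: nat
      using nat_pow_closed[OF u, of m] less.prems True by (auto simp: mem_carrier_iff)
    then show ?thesis using True by (intro exI[of _ 1]) simp
  next
    case False
    with less.prems have ij: "i < j" by simp
    have "\<forall>s\<in>{i..<j}. \<exists>P. degree P \<le> s - i \<and> (\<forall>m::nat. poly P (of_nat m) = (u [^] m) $$ (i, s))"
      using less by auto
    then obtain P where P: "\<And>s. s \<in> {i..<j} \<Longrightarrow> degree (P s) \<le> s - i"
      "\<And>s m. s \<in> {i..<j} \<Longrightarrow> poly (P s) (of_nat m) = (u [^] (m::nat)) $$ (i, s)"
      by metis
    define Q where "Q = (\<Sum>s=i..<j. smult (u $$ (s, j)) (P s))"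
    have "coeff Q k = 0" if "k \<ge> j - i" for k
    proof -
      have "coeff (P s) k = 0" if "s \<in> {i..<j}" for s
        using P(1)[OF that] \<open>k \<ge> j - i\<close> that by (intro coeff_eq_0) auto
      then show ?thesis by (simp add: Q_def coeff_sum)
    qed
    moreover have "j - i < CHAR('a)" using less.prems n_le_char by simp
    ultimately obtain R where R: "degree R \<le> j - i" "poly R 0 = 0"
      "\<And>x. poly R (x + 1) = poly R x + poly Q x"
      using antidifference_poly[of "j - i" Q] by blast
    have "poly R (of_nat m) = (u [^] m) $$ (i, j)" for m :: nat
    proof (induction m)
      case 0
      then show ?case using R(2) ij less.prems by (simp add: one_eq)
    next
      case (Suc m)
      have "(u [^] Suc m) $$ (i, j) = (\<Sum>s=i..j. (u [^] m) $$ (i, s) * u $$ (s, j))"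
        using mult_entry[OF nat_pow_closed[OF u, of m] u] less.prems by simp
      also have "{i..j} = insert j {i..<j}" using ij by auto
      also have "(\<Sum>s\<in>insert j {i..<j}. (u [^] m) $$ (i, s) * u $$ (s, j)) =
          (u [^] m) $$ (i, j) + poly Q (of_nat m)"
        using u less.prems
        by (simp add: mem_carrier_iff Q_def poly_sum P(2) mult.commute)
      also have "\<dots> = poly R (of_nat (Suc m))"
        using R(3)[of "of_nat m"] Suc by (simp add: add.commute)
      finally show ?case by simp
    qed
    then show ?thesis using R(1) by blast
  qed
qed

text \<open>The degree bound makes the chosen polynomial unique whenever one exists. Reading the
  logarithm off the powers, instead of from its series, reduces additivity to the power law for
  commuting elements.\<close>

definition log_entry :: "'a mat \<Rightarrow> nat \<Rightarrow> nat \<Rightarrow> 'a" where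
  "log_entry u i j = coeff (SOME P. degree P < CHAR('a) \<and>
     (\<forall>m::nat. poly P (of_nat m) = (u [^] m) $$ (i, j))) 1"

lemma log_entry_eqI:
  assumes "degree P < CHAR('a)" "\<And>m::nat. poly P (of_nat m) = (u [^] m) $$ (i, j)"
  shows "log_entry u i j = coeff P 1"
proof -
  have "(SOME P. degree P < CHAR('a) \<and> (\<forall>m::nat. poly P (of_nat m) = (u [^] m) $$ (i, j))) = P"
    using assms by (intro some_equality) (auto intro!: poly_eq_if_eq_on_nat)
  then show ?thesis by (simp add: log_entry_def)
qed

lemma log_entry_mult:
  assumes u: "u \<in> carrier G" and v: "v \<in> carrier G" and comm: "u \<otimes> v = v \<otimes> u"
    and ij: "i < j" "j < n"
  shows "log_entry (u \<otimes> v) i j = log_entry u i j + log_entry v i j"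
proof -
  have "\<forall>s\<in>{i..j}. \<exists>P. degree P \<le> s - i \<and> (\<forall>m::nat. poly P (of_nat m) = (u [^] m) $$ (i, s))"
    using power_entry_poly[OF u] ij by auto
  then obtain P where P: "\<And>s. s \<in> {i..j} \<Longrightarrow> degree (P s) \<le> s - i"
    "\<And>s m. s \<in> {i..j} \<Longrightarrow> poly (P s) (of_nat m) = (u [^] (m::nat)) $$ (i, s)"
    by metis
  have "\<forall>s\<in>{i..j}. \<exists>Q. degree Q \<le> j - s \<and> (\<forall>m::nat. poly Q (of_nat m) = (v [^] m) $$ (s, j))"
    using power_entry_poly[OF v] ij by auto
  then obtain Q where Q: "\<And>s. s \<in> {i..j} \<Longrightarrow> degree (Q s) \<le> j - s"
    "\<And>s m. s \<in> {i..j} \<Longrightarrow> poly (Q s) (of_nat m) = (v [^] (m::nat)) $$ (s, j)"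
    by metis
  \<comment> \<open>The degrees add up to at most \<open>(s - i) + (j - s) = j - i\<close>, still
    below the characteristic, so \<open>R\<close> is the polynomial defining the logarithm of the
    product.\<close>
  define R where "R = (\<Sum>s=i..j. P s * Q s)"
  have "degree (P s * Q s) \<le> j - i" if "s \<in> {i..j}" for s
    using degree_mult_le[of "P s" "Q s"] P(1)[OF that] Q(1)[OF that] that by auto
  then have "degree R \<le> j - i" unfolding R_def by (intro degree_sum_le) auto
  then have "degree R < CHAR('a)" using ij n_le_char by simp
  moreover have "poly R (of_nat m) = ((u \<otimes> v) [^] m) $$ (i, j)" for m :: nat
    using ij u v
    by (simp add: pow_mult_distrib[OF comm u v] mult_entry R_def poly_sum P(2) Q(2))
  ultimately have "log_entry (u \<otimes> v) i j = coeff R 1" by (rule log_entry_eqI)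
  also have "\<dots> = (\<Sum>s=i..j. coeff (P s) 0 * coeff (Q s) 1 + coeff (P s) 1 * coeff (Q s) 0)"
    by (simp add: R_def coeff_sum coeff_mult)
  \<comment> \<open>Constant coefficients are values at \<open>m = 0\<close>, that is, entries of
    the identity matrix; only the two ends of the sum survive.\<close>
  also have "\<dots> = (\<Sum>s=i..j. (if s = i then coeff (Q s) 1 else 0) + (if s = j then coeff (P s) 1 else 0))"
  proof (intro sum.cong refl)
    fix s assume s: "s \<in> {i..j}"
    have "coeff (P s) 0 = (if s = i then 1 else 0)" "coeff (Q s) 0 = (if s = j then 1 else 0)"
      using P(2)[OF s, of 0] Q(2)[OF s, of 0] s ij by (auto simp: poly_0_coeff_0 one_eq)
    then show "coeff (P s) 0 * coeff (Q s) 1 + coeff (P s) 1 * coeff (Q s) 0 =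
      (if s = i then coeff (Q s) 1 else 0) + (if s = j then coeff (P s) 1 else 0)" by simp
  qed
  also have "\<dots> = coeff (Q i) 1 + coeff (P j) 1"
    using ij by (simp add: sum.distrib)
  also have "coeff (Q i) 1 = log_entry v i j"
    using Q[of i] ij n_le_char by (intro log_entry_eqI[symmetric]) (auto intro: le_less_trans)
  also have "coeff (P j) 1 = log_entry u i j"
    using P[of j] ij n_le_char by (intro log_entry_eqI[symmetric]) (auto intro: le_less_trans)
  finally show ?thesis by (simp add: add.commute)
qed

section \<open>Coordinates on the group, elementary matrices and the pairing with logarithms\<close>

definition unitri_of :: "(nat \<Rightarrow> nat \<Rightarrow> 'a) \<Rightarrow> 'a mat" where
  "unitri_of a = mat n n (\<lambda>(i, j). if i < j then a i j else if i = j then 1 else 0)"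

lemma unitri_of_in_carrier: "unitri_of a \<in> carrier G"
  by (auto simp: mem_carrier_iff unitri_of_def)

lemma range_unitri_of: "range unitri_of = carrier G"
proof
  show "carrier G \<subseteq> range unitri_of"
  proof
    fix u assume "u \<in> carrier G"
    then have "u = unitri_of (\<lambda>i j. u $$ (i, j))"
      by (intro eq_matI) (auto simp: mem_carrier_iff unitri_of_def not_less)
    then show "u \<in> range unitri_of" by blast
  qed
qed (auto simp: unitri_of_in_carrier)

lemma unitri_of_eq_iff: "unitri_of a = unitri_of b \<longleftrightarrow> (\<forall>j<n. \<forall>i<j. a i j = b i j)"
proof
  assume eq: "unitri_of a = unitri_of b"
  show "\<forall>j<n. \<forall>i<j. a i j = b i j"
  proof (intro allI impI)
    fix i j assume "j < n" "i < j"
    then show "a i j = b i j"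
      using arg_cong[OF eq, of "\<lambda>A. A $$ (i, j)"] by (simp add: unitri_of_def)
  qed
qed (auto simp: unitri_of_def intro!: eq_matI)

text \<open>Parameters of elementary matrices at a fixed position add under multiplication, so the
  powers are linear in the exponent. These matrices later separate the characters.\<close>

lemma log_entry_elementary:
  assumes kl: "k < l" "l < n" and ij: "i < j" "j < n"
  shows "log_entry (unitri_of (\<lambda>i j. if i = k \<and> j = l then c else 0)) i j =
    (if i = k \<and> j = l then c else 0)"
proof -
  define E where "E c = unitri_of (\<lambda>i j. if i = k \<and> j = l then c else 0)" for c :: 'a
  have entry: "E c $$ (i, j) = (if i = j then 1 else if i = k \<and> j = l then c else 0)"
    if "i < n" "j < n" for c i j
    using that kl by (auto simp: E_def unitri_of_def)
  have E: "E c \<in> carrier G" for c by (simp add: E_def unitri_of_in_carrier)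
  have mult: "E c \<otimes> E d = E (c + d)" for c d
  proof (rule eq_matI)
    fix i j assume "i < dim_row (E (c + d))" "j < dim_col (E (c + d))"
    then have ij: "i < n" "j < n" by (auto simp: E_def unitri_of_def)
    show "(E c \<otimes> E d) $$ (i, j) = E (c + d) $$ (i, j)"
    proof (cases "i \<le> j")
      case False
      then show ?thesis
        using m_closed[OF E[of c] E[of d]] E[of "c + d"] ij by (auto simp: mem_carrier_iff)
    next
      case True
      \<comment> \<open>A nonzero term with \<open>s\<close> strictly between \<open>i\<close> and
        \<open>j\<close> would need \<open>s = l\<close> and \<open>s = k\<close>, contradicting
        \<open>k < l\<close>.\<close>
      have "E c $$ (i, s) * E d $$ (s, j) = (if s = i then E d $$ (i, j) else 0) +
          (if s = j then (if i = k \<and> j = l then c else 0) else 0)" if "s \<in> {i..j}" for s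
        using that ij kl by (auto simp: entry)
      then have "(E c \<otimes> E d) $$ (i, j) = E d $$ (i, j) + (if i = k \<and> j = l then c else 0)"
        using True ij by (simp add: mult_entry E sum.distrib)
      then show ?thesis using ij kl by (auto simp: entry)
    qed
  qed (use m_closed[OF E[of c] E[of d]] E[of "c + d"] in \<open>auto simp: mem_carrier_iff\<close>)
  have "E c [^] m = E (of_nat m * c)" for m :: nat
  proof (induction m)
    case 0
    have "\<one> = E 0" by (rule eq_matI) (auto simp: one_eq E_def unitri_of_def)
    then show ?case by simp
  next
    case (Suc m)
    then show ?case by (simp add: mult algebra_simps)
  qed
  \<comment> \<open>From \<open>k < l < n\<close> the characteristic is at least 2, so degree one is
    admissible.\<close>
  then have "log_entry (E c) i j = coeff [:0, if i = k \<and> j = l then c else 0:] 1"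
    using ij kl n_le_char by (intro log_entry_eqI) (auto simp: entry)
  then show ?thesis by (simp add: E_def)
qed

text \<open>The general linear functional on strictly upper triangular matrices, applied to the
  logarithm of \<open>u\<close>.\<close>

definition log_pairing :: "(nat \<Rightarrow> nat \<Rightarrow> 'a) \<Rightarrow> 'a mat \<Rightarrow> 'a" where
  "log_pairing a u = (\<Sum>j<n. \<Sum>i<j. a i j * log_entry u i j)"

lemma log_pairing_mult:
  assumes "u \<in> carrier G" "v \<in> carrier G" "u \<otimes> v = v \<otimes> u"
  shows "log_pairing a (u \<otimes> v) = log_pairing a u + log_pairing a v"
  by (simp add: log_pairing_def log_entry_mult[OF assms] distrib_left sum.distrib)

lemma log_pairing_add:
  "log_pairing (\<lambda>i j. a i j + b i j) u = log_pairing a u + log_pairing b u"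
  by (simp add: log_pairing_def distrib_right sum.distrib)

lemma log_pairing_elementary:
  assumes "k < l" "l < n"
  shows "log_pairing a (unitri_of (\<lambda>i j. if i = k \<and> j = l then c else 0)) = a k l * c"
proof -
  have "log_pairing a (unitri_of (\<lambda>i j. if i = k \<and> j = l then c else 0)) =
      (\<Sum>j<n. \<Sum>i<j. if j = l then if i = k then a k l * c else 0 else 0)"
    unfolding log_pairing_def
    by (intro sum.cong refl) (auto simp: log_entry_elementary[OF assms])
  also have "\<dots> = (\<Sum>j<n. if j = l then a k l * c else 0)"
    using assms by (intro sum.cong) auto
  also have "\<dots> = a k l * c" using assms by simp
  finally show ?thesis .
qed

end

section \<open>The subgroup of linear semicharacters\<close>

theorem theorem5p3:
  fixes n :: nat
  assumes "n > 0"
    and "n \<le> CHAR('a::{field,finite})"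
  shows "Coset.order (unitriangular_group TYPE('a) n)
           dvd Coset.order (semicharacter_group (unitriangular_group TYPE('a) n))"
proof -
  define G where "G = unitriangular_group TYPE('a) n"
  interpret unitriangular n G using assms(2) by unfold_locales (auto simp: G_def)
  let ?S = "semicharacter_group G"
  interpret S: comm_group ?S by (rule comm_group_semicharacter_group[OF is_group])
  obtain \<psi> :: "'a \<Rightarrow> complex" where \<psi>_add: "\<And>x y. \<psi> (x + y) = \<psi> x * \<psi> y"
    and \<psi>_0: "\<psi> 0 = 1" and \<psi>_nontrivial: "\<exists>x. \<psi> x \<noteq> 1"
    using exists_nontrivial_additive_character by metis
  have \<psi>_neg: "\<psi> x * \<psi> (- x) = 1" for x using \<psi>_add[of x "- x"] \<psi>_0 by simp
  have \<psi>_nz: "\<psi> x \<noteq> 0" for x using \<psi>_neg[of x] by auto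
  define chi where "chi a = (\<lambda>u\<in>carrier G. \<psi> (log_pairing a u))" for a
  have chi_closed: "chi a \<in> carrier ?S" for a
    by (auto simp: semicharacter_group_def semicharacters_def chi_def \<psi>_nz \<psi>_add log_pairing_mult)
  have chi_mult: "chi a \<otimes>\<^bsub>?S\<^esub> chi b = chi (\<lambda>i j. a i j + b i j)" for a b
    by (auto simp: semicharacter_group_def chi_def log_pairing_add \<psi>_add)
  have chi_zero: "chi (\<lambda>i j. 0) = \<one>\<^bsub>?S\<^esub>"
    by (auto simp: semicharacter_group_def chi_def log_pairing_def \<psi>_0)
  have "subgroup (range chi) ?S"
  proof (rule S.subgroupI)
    fix f assume "f \<in> range chi"
    then obtain a where f: "f = chi a" by auto
    have "chi (\<lambda>i j. - a i j) \<otimes>\<^bsub>?S\<^esub> chi a = \<one>\<^bsub>?S\<^esub>"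
      by (simp add: chi_mult chi_zero)
    then have "inv\<^bsub>?S\<^esub> f = chi (\<lambda>i j. - a i j)"
      unfolding f by (intro S.inv_equality chi_closed)
    then show "inv\<^bsub>?S\<^esub> f \<in> range chi" by simp
  qed (use chi_closed in \<open>auto simp: chi_mult\<close>)
  then have "card (range chi) dvd Coset.order ?S"
    using S.lagrange by (metis dvd_triv_right)
  \<comment> \<open>\<open>chi\<close> and \<open>unitri_of\<close> have the same fibres on an
    infinite index type, so their ranges are equinumerous, and the range of \<open>unitri_of\<close>
    is the group.\<close>
  moreover have chi_eq_iff: "chi a = chi b \<longleftrightarrow> unitri_of a = unitri_of b" for a b
  proof
    assume eq: "chi a = chi b"
    show "unitri_of a = unitri_of b"
      unfolding unitri_of_eq_iff
    proof (intro allI impI)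
      fix k l assume kl: "l < n" "k < l"
      have eq_c: "\<psi> (a k l * c) = \<psi> (b k l * c)" for c
        using fun_cong[OF eq, of "unitri_of (\<lambda>i j. if i = k \<and> j = l then c else 0)"] kl
        by (simp add: chi_def unitri_of_in_carrier log_pairing_elementary)
      show "a k l = b k l"
      proof (rule ccontr)
        assume ne: "a k l \<noteq> b k l"
        have "\<psi> x = 1" for x
        proof -
          \<comment> \<open>Equality on all elementary matrices makes \<open>\<psi>\<close> trivial
            on all multiples of \<open>a k l - b k l\<close>; this \<open>c\<close> makes the
            multiple an arbitrary \<open>x\<close>.\<close>
          define c where "c = x / (a k l - b k l)"
          have "(a k l - b k l) * c = x" using ne by (simp add: c_def)
          then have "x = a k l * c + - (b k l * c)" by (simp add: left_diff_distrib)
          then show ?thesis using \<psi>_neg eq_c \<psi>_add by metis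
        qed
        then show False using \<psi>_nontrivial by simp
      qed
    qed
  qed (auto simp: unitri_of_eq_iff chi_def log_pairing_def intro!: sum.cong arg_cong[of _ _ \<psi>])
  have "card (range chi) = Coset.order G"
  proof -
    \<comment> \<open>A section \<open>g\<close> of \<open>unitri_of\<close> turns the equality of
      fibres into a bijection from the group onto the characters.\<close>
    obtain g where g: "\<And>A. A \<in> carrier G \<Longrightarrow> unitri_of (g A) = A"
      using f_inv_into_f[of _ unitri_of UNIV] unfolding range_unitri_of by blast
    have inj: "inj_on (\<lambda>A. chi (g A)) (carrier G)"
      by (rule inj_onI) (metis g chi_eq_iff)
    have "(\<lambda>A. chi (g A)) ` carrier G = range chi"
    proof
      show "range chi \<subseteq> (\<lambda>A. chi (g A)) ` carrier G"
      proof
        fix f assume "f \<in> range chi"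
        then obtain a where "f = chi a" by auto
        then have "f = chi (g (unitri_of a))"
          by (simp add: chi_eq_iff g unitri_of_in_carrier)
        then show "f \<in> (\<lambda>A. chi (g A)) ` carrier G"
          using unitri_of_in_carrier by blast
      qed
    qed auto
    then show ?thesis using card_image[OF inj] by (simp add: Coset.order_def)
  qed
  ultimately show ?thesis by (simp add: G_def)
qed

end
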